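(* Let $G$ be a finite simple connected walk-regular graph. For all pairs of vertices $u,v$ (with $u\neq v$) and $w,z$ (with $w\ne z$) of $G$, the following statements are equivalent: (a) $\operatorname{sp}(G-u-v)=\operatorname{sp}(G-w-z)$. (b) $\operatorname{sp}(G+uu+vv)=\operatorname{sp}(G+ww+zz)$. (c) $\operatorname{sp}(G+u\bar u+v\bar v)=\operatorname{sp}(G+w\bar w+z\bar z)$.
   Context: $\operatorname{sp}$ denotes the spectrum (eigenvalues with multiplicities) of the adjacency matrix of a graph or pseudograph (a graph possibly with loops and multiple edges). A graph with adjacency matrix $A$ is walk-regular if for every $\ell\ge 0$ the number $(A^\ell)_{uu}$ of closed walks of length $\ell$ at $u$ does not depend on the vertex $u$. $G-u-v$ is the graph obtained from $G$ by removing the vertices $u,v$ and all edges incident to them. $G+uu+vv$ is the pseudograph obtained by adding a loop at $u$ and a loop at $v$, so that its adjacency matrix is $A$ with the $uu$- and $vv$-entries changed to $1$. $G+u\bar u+v\bar v$ is the graph obtained by adding two new vertices $\bar u,\bar v$, with $\bar u$ adjacent only to $u$ and $\bar v$ adjacent only to $v$. *)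

theory Defs
  imports
    "Graph_Theory.Pair_Digraph"
    "Graph_Theory.Digraph_Component"
    "Jordan_Normal_Form.Char_Poly"
begin

text \<open>
  Undirected (pseudo)graphs are symmetric digraphs: an edge between distinct vertices is a pair of
  opposite arcs, whereas a loop is a single arc and hence contributes 1 to the diagonal of the
  adjacency matrix. Finite simple graphs are the instances of \<^locale>\<open>pair_graph\<close>.
\<close>

text \<open>
  An arbitrary enumeration of the (finite) vertex set, used to index the adjacency matrix. A
  different choice conjugates the matrix by a permutation matrix, which affects neither its
  spectrum nor walk-regularity.
\<close>
definition vertex_list :: "('a, 'b) pre_digraph \<Rightarrow> 'a list" where
  "vertex_list G = (SOME vs. set vs = verts G \<and> distinct vs)"

definition adj_matrix :: "('a, 'b) pre_digraph \<Rightarrow> complex mat" where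
  "adj_matrix G = (let vs = vertex_list G in
     mat (length vs) (length vs)
       (\<lambda>(i, j). of_nat (card {e \<in> arcs G. tail G e = vs ! i \<and> head G e = vs ! j})))"

text \<open>The complex eigenvalues, counted with algebraic multiplicity.\<close>
definition sp :: "('a, 'b) pre_digraph \<Rightarrow> complex multiset" where
  "sp G = proots (char_poly (adj_matrix G))"

definition walk_regular :: "('a, 'b) pre_digraph \<Rightarrow> bool" where
  "walk_regular G \<longleftrightarrow> (\<forall>l. \<forall>i < dim_row (adj_matrix G). \<forall>j < dim_row (adj_matrix G).
     (adj_matrix G ^\<^sub>m l) $$ (i, i) = (adj_matrix G ^\<^sub>m l) $$ (j, j))"

definition remove_two :: "'a pair_pre_digraph \<Rightarrow> 'a \<Rightarrow> 'a \<Rightarrow> ('a, 'a \<times> 'a) pre_digraph" where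
  "remove_two G u v = pre_digraph.del_vert (pre_digraph.del_vert (with_proj G) u) v"

definition add_two_loops :: "'a pair_pre_digraph \<Rightarrow> 'a \<Rightarrow> 'a \<Rightarrow> ('a, 'a \<times> 'a) pre_digraph" where
  "add_two_loops G u v = pre_digraph.add_arc (pre_digraph.add_arc (with_proj G) (u, u)) (v, v)"

text \<open>
  Each old vertex \<open>x\<close> becomes \<open>Inl x\<close>; the new pendant vertices at \<open>u\<close> and \<open>v\<close> are \<open>Inr u\<close>
  and \<open>Inr v\<close>.
\<close>
definition add_two_pendants ::
  "'a pair_pre_digraph \<Rightarrow> 'a \<Rightarrow> 'a \<Rightarrow> ('a + 'a, ('a + 'a) \<times> ('a + 'a)) pre_digraph" where
  "add_two_pendants G u v = with_proj \<lparr>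
     pverts = Inl ` pverts G \<union> {Inr u, Inr v},
     parcs = map_prod Inl Inl ` parcs G \<union>
       {(Inl u, Inr u), (Inr u, Inl u), (Inl v, Inr v), (Inr v, Inl v)}\<rparr>"

end

theory Submission
  imports Defs "HOL-Computational_Algebra.Fundamental_Theorem_Algebra"
begin

text \<open>
  Write \<open>\<phi>(S)\<close> for the principal minor of \<open>xI - A\<close> on a vertex set \<open>S\<close>, and \<open>V\<close> for the set of
  all vertices. Expanding determinants gives the characteristic polynomials
  \<open>\<phi>(V) - \<phi>(V - u) - \<phi>(V - v) + \<phi>(V - u - v)\<close> for two added loops and
  \<open>x\<^sup>2 \<phi>(V) - x (\<phi>(V - u) + \<phi>(V - v)) + \<phi>(V - u - v)\<close> for two pendant vertices.
  Walk-regularity makes \<open>\<phi>(V - u)\<close>, a diagonal entry of \<open>adj (xI - A)\<close>, independent of \<open>u\<close>, so in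
  all three constructions the spectrum determines and is determined by \<open>\<phi>(V - u - v)\<close>.
\<close>

section \<open>Determinants indexed by finite sets\<close>

text \<open>
  Indexing determinants by sets of vertices makes them independent of the enumerations chosen by
  \<^const>\<open>vertex_list\<close>, which are unrelated for a graph and its modifications.
\<close>
definition set_det :: "'a set \<Rightarrow> ('a \<Rightarrow> 'a \<Rightarrow> 'b :: comm_ring_1) \<Rightarrow> 'b" where
  "set_det S f = (\<Sum>p | p permutes S. of_int (sign p) * (\<Prod>x\<in>S. f x (p x)))"

lemma set_det_cong:
  assumes "S = T" and "\<And>x y. x \<in> T \<Longrightarrow> y \<in> T \<Longrightarrow> f x y = g x y"
  shows "set_det S f = set_det T g"
  unfolding set_det_def using assms
  by (auto intro!: sum.cong prod.cong arg_cong2[where f = "(*)"] simp: permutes_in_image)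

text \<open>Conjugation by \<open>h\<close> maps the permutations of \<open>A\<close> bijectively
  onto those of its image and preserves signs. It serves both for enumerating vertices and for the
  embedding \<open>Inl\<close>.\<close>

lemma set_det_image:
  assumes "finite A" and "inj_on h A"
  shows "set_det (h ` A) f = set_det A (\<lambda>x y. f (h x) (h y))"
proof -
  have bij: "bij_betw h A (h ` A)"
    using assms by (simp add: bij_betw_def)
  have "bij_betw (map_permutation A h) {p. p permutes A} {p. p permutes h ` A}"
    using bij_betw_permutations[OF bij]
    by (simp add: map_permutation_def[abs_def] restrict_id_def o_def)
  then have "set_det (h ` A) f = (\<Sum>p | p permutes A. of_int (sign (map_permutation A h p)) *
      (\<Prod>x\<in>h ` A. f x (map_permutation A h p x)))"
    unfolding set_det_def by (rule sum.reindex_bij_betw[symmetric])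
  also have "\<dots> = set_det A (\<lambda>x y. f (h x) (h y))"
    unfolding set_det_def
  proof (intro sum.cong refl arg_cong2[where f = "(*)"])
    fix p assume p: "p \<in> {p. p permutes A}"
    show "of_int (sign (map_permutation A h p)) = (of_int (sign p) :: 'c)"
      using p assms by (simp add: sign_map_permutation)
    show "(\<Prod>x\<in>h ` A. f x (map_permutation A h p x)) = (\<Prod>x\<in>A. f (h x) (h (p x)))"
      using assms by (simp add: prod.reindex map_permutation_def restrict_id_def)
  qed
  finally show ?thesis .
qed

lemma det_mat_list:
  assumes "distinct vs"
  shows "det (mat (length vs) (length vs) (\<lambda>(i, j). f (vs ! i) (vs ! j))) = set_det (set vs) f"
proof -
  have "set vs = (!) vs ` {0..<length vs}"
    by (auto simp: in_set_conv_nth)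
  moreover have "inj_on ((!) vs) {0..<length vs}"
    using assms by (auto simp: inj_on_def nth_eq_iff_index_eq)
  ultimately have "set_det (set vs) f = set_det {0..<length vs} (\<lambda>i j. f (vs ! i) (vs ! j))"
    by (simp add: set_det_image)
  also have "\<dots> = det (mat (length vs) (length vs) (\<lambda>(i, j). f (vs ! i) (vs ! j)))"
    unfolding set_det_def det_def
    by (auto intro!: sum.cong prod.cong arg_cong2[where f = "(*)"] simp: permutes_in_image)
  finally show ?thesis ..
qed

section \<open>Row expansion, diagonal changes and pendant rows\<close>

text \<open>Each permutation of \<open>insert a S\<close> is uniquely
  \<open>transpose a b \<circ> q\<close> with \<open>q\<close> permuting \<open>S\<close>, and it
  sends \<open>a\<close> to \<open>b\<close>. The cofactors stay raw sums over \<open>q\<close>,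
  because for \<open>b \<noteq> a\<close> they are not principal minors of \<open>f\<close>.\<close>

lemma set_det_expand:
  assumes "finite S" and "a \<notin> S"
  shows "set_det (insert a S) f = (\<Sum>b\<in>insert a S. f a b *
    (\<Sum>q | q permutes S. of_int (sign (transpose a b \<circ> q)) * (\<Prod>x\<in>S. f x (transpose a b (q x)))))"
proof -
  have "(\<Prod>x\<in>insert a S. f x ((transpose a b \<circ> q) x)) =
      f a b * (\<Prod>x\<in>S. f x (transpose a b (q x)))" if "q permutes S" for b q
    using that assms by (simp add: permutes_not_in)
  then show ?thesis
    unfolding set_det_def sum_over_permutations_insert[OF assms] sum_distrib_left
    by (intro sum.cong refl) (auto simp: mult_ac)
qed

text \<open>Only row \<open>a\<close> changes, and the cofactors of that row do not involve its
  entries; the cofactor at the diagonal position is the principal minor on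
  \<open>S - {a}\<close>.\<close>

lemma set_det_add_diagonal:
  assumes "finite S" and "a \<in> S"
  shows "set_det S (\<lambda>x y. if x = a \<and> y = a then f x y + c else f x y) =
    set_det S f + c * set_det (S - {a}) f"
proof -
  define T where "T = S - {a}"
  have S: "S = insert a T" "finite T" "a \<notin> T"
    using assms by (auto simp: T_def)
  define g where "g = (\<lambda>x y. if x = a \<and> y = a then f x y + c else f x y)"
  define C where "C b = (\<Sum>q | q permutes T. of_int (sign (transpose a b \<circ> q)) *
    (\<Prod>x\<in>T. f x (transpose a b (q x))))" for b
  have g_row: "g x y = f x y" if "x \<in> T" for x y
    using that S by (auto simp: g_def)
  have g: "set_det S g = (\<Sum>b\<in>insert a T. g a b * C b)"
    unfolding S(1) set_det_expand[OF S(2,3)] C_def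
    by (intro sum.cong prod.cong refl arg_cong2[where f = "(*)"]) (simp_all add: g_row)
  have f: "set_det S f = (\<Sum>b\<in>insert a T. f a b * C b)"
    unfolding S(1) set_det_expand[OF S(2,3)] C_def ..
  have "C a = set_det T f"
    by (simp add: C_def set_det_def)
  moreover have "(\<Sum>b\<in>T. g a b * C b) = (\<Sum>b\<in>T. f a b * C b)"
    using S by (intro sum.cong refl) (auto simp: g_def)
  ultimately have "set_det S g = set_det S f + c * set_det T f"
    using S unfolding f g by (simp add: g_def algebra_simps)
  then show ?thesis
    by (simp add: g_def T_def)
qed

text \<open>If \<open>p\<close> moves \<open>a\<close>, then \<open>p x = a\<close> for some
  \<open>x \<noteq> a\<close>, and the product contains the zero \<open>f x a\<close>. The remaining
  permutations fix \<open>a\<close>, so they are those of \<open>S - {a}\<close>.\<close>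

lemma set_det_single_column:
  assumes "finite S" and "a \<in> S" and zero: "\<And>x. x \<in> S \<Longrightarrow> x \<noteq> a \<Longrightarrow> f x a = 0"
  shows "set_det S f = f a a * set_det (S - {a}) f"
proof -
  have perms: "p permutes (S - {a}) \<longleftrightarrow> p permutes S \<and> p a = a" for p
    using permutes_superset[of p S "S - {a}"] permutes_subset[of p "S - {a}" S] permutes_not_in[of p "S - {a}" a]
    by auto
  have "set_det S f = (\<Sum>p | p permutes (S - {a}). of_int (sign p) * (\<Prod>x\<in>S. f x (p x)))"
    unfolding set_det_def
  proof (rule sum.mono_neutral_right)
    show "\<forall>p\<in>{p. p permutes S} - {p. p permutes (S - {a})}.
        of_int (sign p) * (\<Prod>x\<in>S. f x (p x)) = 0"
    proof
      fix p assume "p \<in> {p. p permutes S} - {p. p permutes (S - {a})}"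
      then have p: "p permutes S" "p a \<noteq> a"
        by (auto simp: perms)
      then obtain x where "p x = a" "x \<in> S"
        using assms(2) by (metis permutes_image imageE)
      moreover from this have "x \<noteq> a"
        using p by auto
      ultimately have "f x (p x) = 0"
        using zero by simp
      with \<open>x \<in> S\<close> have "(\<Prod>x\<in>S. f x (p x)) = 0"
        using assms(1) by (metis prod_zero)
      then show "of_int (sign p) * (\<Prod>x\<in>S. f x (p x)) = 0"
        by simp
    qed
  qed (use assms in \<open>auto simp: perms finite_permutations\<close>)
  also have "\<dots> = f a a * set_det (S - {a}) f"
    unfolding set_det_def sum_distrib_left
    using assms by (intro sum.cong refl) (auto simp: perms prod.remove[of S a] mult_ac)
  finally show ?thesis .
qed

lemma set_det_pendant:
  assumes "finite S" and "b \<notin> S" and "u \<in> S"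
    and row: "\<And>x. x \<in> S \<Longrightarrow> x \<noteq> u \<Longrightarrow> f b x = 0"
    and col: "\<And>x. x \<in> S \<Longrightarrow> x \<noteq> u \<Longrightarrow> f x b = 0"
  shows "set_det (insert b S) f =
    f b b * set_det S f - f b u * f u b * set_det (S - {u}) f"
proof -
  define C where "C c = (\<Sum>q | q permutes S. of_int (sign (transpose b c \<circ> q)) *
    (\<Prod>x\<in>S. f x (transpose b c (q x))))" for c
  \<comment> \<open>On \<open>S\<close>, \<open>g\<close> is \<open>f\<close> with column
    \<open>u\<close> replaced by column \<open>b\<close>. By \<open>col\<close> that column vanishes
    outside row \<open>u\<close>, so \<open>set_det_single_column\<close> evaluates the cofactor
    \<open>C u\<close>; the swap of columns costs the sign in \<open>sgn\<close>.\<close>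
  define g where "g = (\<lambda>x y. f x (transpose b u y))"
  have "b \<noteq> u"
    using assms by auto
  have sgn: "sign (transpose b u \<circ> q) = - sign q" if "q permutes S" for q
    using that \<open>finite S\<close> \<open>b \<noteq> u\<close>
    by (subst sign_compose) (auto simp: sign_swap_id permutation_swap_id intro: permutes_imp_permutation)
  have "C u = (\<Sum>q | q permutes S. - (of_int (sign q) * (\<Prod>x\<in>S. g x (q x))))"
    unfolding C_def by (intro sum.cong refl) (simp add: sgn g_def)
  also have "\<dots> = - set_det S g"
    unfolding set_det_def by (rule sum_negf)
  also have "set_det S g = g u u * set_det (S - {u}) g"
    using assms by (intro set_det_single_column) (auto simp: g_def)
  also have "set_det (S - {u}) g = set_det (S - {u}) f"
    using assms by (intro set_det_cong) (auto simp: g_def transpose_def)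
  finally have Cu: "C u = - (f u b * set_det (S - {u}) f)"
    by (simp add: g_def)
  have Cb: "C b = set_det S f"
    by (simp add: C_def set_det_def)
  have "set_det (insert b S) f = (\<Sum>c\<in>insert b S. f b c * C c)"
    unfolding set_det_expand[OF assms(1,2)] C_def ..
  also have "\<dots> = (\<Sum>c\<in>{b, u}. f b c * C c)"
    using assms by (intro sum.mono_neutral_right) auto
  also have "\<dots> = f b b * C b + f b u * C u"
    using \<open>b \<noteq> u\<close> by simp
  finally show ?thesis
    by (simp add: Cb Cu)
qed

section \<open>Diagonal of the adjugate from diagonals of powers\<close>

text \<open>
  The coefficients of \<open>adj (xI - A)\<close> are polynomials in \<open>A\<close>: comparing coefficients in
  \<open>(xI - A) adj (xI - A) = det (xI - A) I\<close> expresses each one through the next higher one.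
\<close>
lemma adj_char_poly_matrix_diagonal:
  fixes A :: "'a :: comm_ring_1 mat"
  assumes A: "A \<in> carrier_mat n n"
    and diag: "\<And>l i j. i < n \<Longrightarrow> j < n \<Longrightarrow> (A ^\<^sub>m l) $$ (i, i) = (A ^\<^sub>m l) $$ (j, j)"
    and "i < n" and "j < n"
  shows "adj_mat (char_poly_matrix A) $$ (i, i) = adj_mat (char_poly_matrix A) $$ (j, j)"
proof -
  define C where "C = char_poly_matrix A"
  define B where "B = adj_mat C"
  define K where "K k = mat n n (\<lambda>(i, j). coeff (B $$ (i, j)) k)" for k
  have C: "C \<in> carrier_mat n n"
    using A by (simp add: C_def)
  note B = adj_mat[OF C, folded B_def]
  have K: "K k \<in> carrier_mat n n" for k
    by (simp add: K_def)
  have C_entry: "C $$ (i, m) = (if i = m then [:0, 1:] else 0) - [:A $$ (i, m):]"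
    if "i < n" "m < n" for i m
    using A that by (auto simp: C_def char_poly_matrix_def)
  \<comment> \<open>\<open>K k\<close> is the matrix coefficient of degree \<open>k\<close> in
    \<open>B\<close>. Coefficient \<open>Suc k\<close> of \<open>C * B\<close> is compared with that
    of \<open>det C\<close> times the identity; the indeterminate on the diagonal of
    \<open>C\<close> lowers the index to \<open>k\<close>.\<close>
  have K_rec: "K k = A * K (Suc k) + coeff (det C) (Suc k) \<cdot>\<^sub>m 1\<^sub>m n" for k
  proof (rule eq_matI)
    fix i j assume "i < dim_row (A * K (Suc k) + coeff (det C) (Suc k) \<cdot>\<^sub>m 1\<^sub>m n)"
      and "j < dim_col (A * K (Suc k) + coeff (det C) (Suc k) \<cdot>\<^sub>m 1\<^sub>m n)"
    then have i: "i < n" and j: "j < n"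
      by simp_all
    have "(\<Sum>m = 0..<n. C $$ (i, m) * B $$ (m, j)) = (C * B) $$ (i, j)"
      using B(1) C i j by (simp add: scalar_prod_def)
    also have "\<dots> = (det C \<cdot>\<^sub>m 1\<^sub>m n) $$ (i, j)"
      by (simp only: B)
    finally have "coeff ((det C \<cdot>\<^sub>m 1\<^sub>m n) $$ (i, j)) (Suc k) =
        (\<Sum>m = 0..<n. coeff (C $$ (i, m) * B $$ (m, j)) (Suc k))"
      by (simp only: coeff_sum[symmetric])
    also have "\<dots> = (\<Sum>m = 0..<n. (if i = m then coeff (B $$ (m, j)) k else 0)
        - A $$ (i, m) * coeff (B $$ (m, j)) (Suc k))"
      using i by (intro sum.cong refl) (auto simp: C_entry algebra_simps)
    also have "\<dots> = coeff (B $$ (i, j)) k - (\<Sum>m = 0..<n. A $$ (i, m) * coeff (B $$ (m, j)) (Suc k))"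
      using i by (simp add: sum_subtractf)
    also have "(\<Sum>m = 0..<n. A $$ (i, m) * coeff (B $$ (m, j)) (Suc k)) = (A * K (Suc k)) $$ (i, j)"
      using A i j by (simp add: scalar_prod_def K_def)
    finally show "K k $$ (i, j) = (A * K (Suc k) + coeff (det C) (Suc k) \<cdot>\<^sub>m 1\<^sub>m n) $$ (i, j)"
      using i j A by (simp add: K_def split: if_splits)
  qed (use A in \<open>auto simp: K_def\<close>)
  \<comment> \<open>\<open>N\<close> exceeds the degree of every entry of \<open>B\<close>, so
    \<open>K N = 0\<close> can start a downward induction. The inserted 0 makes the argument of
    \<open>Max\<close> visibly nonempty.\<close>
  define N where "N = Suc (Max (insert 0 ((\<lambda>(i, j). degree (B $$ (i, j))) ` ({0..<n} \<times> {0..<n}))))"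
  have deg: "degree (B $$ (i, j)) < N" if "i < n" "j < n" for i j
  proof -
    have "degree (B $$ (i, j)) \<in> insert 0 ((\<lambda>(i, j). degree (B $$ (i, j))) ` ({0..<n} \<times> {0..<n}))"
      using that by force
    then show ?thesis
      unfolding N_def by (intro le_imp_less_Suc Max_ge) auto
  qed
  \<comment> \<open>All left factors \<open>A ^\<^sub>m l\<close> are treated at once, because
    \<open>K_rec\<close> passes to the next higher coefficient at the price of one more factor
    \<open>A\<close>.\<close>
  have const: "(A ^\<^sub>m l * K (N - d)) $$ (i, i) = (A ^\<^sub>m l * K (N - d)) $$ (j, j)"
    if "i < n" "j < n" for l d i j
    using that
  proof (induction d arbitrary: l i j)
    case 0
    have "K N = 0\<^sub>m n n"
      by (rule eq_matI) (auto simp: K_def coeff_eq_0 deg)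
    then show ?case
      using 0 A by (simp add: right_mult_zero_mat[of _ n])
  next
    case (Suc d)
    show ?case
    proof (cases "N \<le> d")
      \<comment> \<open>Truncated subtraction makes \<open>N - Suc d\<close> and
        \<open>N - d\<close> both 0 here.\<close>
      case True
      then show ?thesis
        using Suc.IH[OF Suc.prems, of l] by simp
    next
      case False
      then have N: "Suc (N - Suc d) = N - d"
        by simp
      define c where "c = coeff (det C) (N - d)"
      have Al: "A ^\<^sub>m l \<in> carrier_mat n n"
        using A by simp
      have "A ^\<^sub>m l * K (N - Suc d) = A ^\<^sub>m l * (A * K (N - d) + c \<cdot>\<^sub>m 1\<^sub>m n)"
        by (subst K_rec) (simp only: N c_def)
      also have "\<dots> = A ^\<^sub>m l * (A * K (N - d)) + A ^\<^sub>m l * (c \<cdot>\<^sub>m 1\<^sub>m n)"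
        by (intro mult_add_distrib_mat[OF Al mult_carrier_mat[OF A K]]) simp
      also have "A ^\<^sub>m l * (A * K (N - d)) = A ^\<^sub>m Suc l * K (N - d)"
        using assoc_mult_mat[OF Al A K] by simp
      also have "A ^\<^sub>m l * (c \<cdot>\<^sub>m 1\<^sub>m n) = c \<cdot>\<^sub>m A ^\<^sub>m l"
        using Al by (simp add: mult_smult_distrib[OF Al one_carrier_mat] right_mult_one_mat[OF Al])
      finally have step: "A ^\<^sub>m l * K (N - Suc d) = A ^\<^sub>m Suc l * K (N - d) + c \<cdot>\<^sub>m A ^\<^sub>m l" .
      show ?thesis
        unfolding step using Suc.IH[OF Suc.prems, of "Suc l"] diag[OF Suc.prems, of l] Suc.prems Al K A
        by (simp del: pow_mat.simps)
    qed
  qed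
  have "B $$ (i, i) = B $$ (j, j)"
  proof (rule poly_eqI)
    fix k
    show "coeff (B $$ (i, i)) k = coeff (B $$ (j, j)) k"
    proof (cases "k < N")
      case True
      \<comment> \<open>The choice \<open>l = 0\<close>, \<open>d = N - k\<close> recovers
        \<open>K k\<close> itself.\<close>
      have "(A ^\<^sub>m 0 * K (N - (N - k))) $$ (i, i) = (A ^\<^sub>m 0 * K (N - (N - k))) $$ (j, j)"
        using assms by (intro const)
      then show ?thesis
        using True assms A K left_mult_one_mat[OF K] by (simp add: K_def)
    next
      case False
      then show ?thesis
        using deg[of i i] deg[of j j] assms(3,4) by (simp add: coeff_eq_0)
    qed
  qed
  then show ?thesis
    by (simp add: B_def C_def)
qed

section \<open>Spectra, characteristic polynomials and principal minors\<close>

text \<open>A complex polynomial is its leading coefficient times the product of linear factors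
  given by \<open>proots\<close>.\<close>

lemma proots_eq_iff_monic:
  fixes p q :: "complex poly"
  assumes "lead_coeff p = 1" and "lead_coeff q = 1"
  shows "proots p = proots q \<longleftrightarrow> p = q"
  using complex_poly_decompose_multiset[of p] complex_poly_decompose_multiset[of q] assms
  by (metis smult_1_left)

text \<open>The characteristic matrix addressed by vertices instead of indices. Membership in
  \<open>E\<close> replaces the arc count, which is the same when arcs are vertex pairs.\<close>

definition char_entry :: "('a \<times> 'a) set \<Rightarrow> 'a \<Rightarrow> 'a \<Rightarrow> complex poly" where
  "char_entry E x y = (if x = y then [:0, 1:] else 0) - (if (x, y) \<in> E then 1 else 0)"

lemma vertex_list:
  assumes "finite (verts H)"
  shows "set (vertex_list H) = verts H" and "distinct (vertex_list H)"
  using someI_ex[OF finite_distinct_list[OF assms]] by (simp_all add: vertex_list_def)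

lemma adj_matrix_carrier:
  "adj_matrix H \<in> carrier_mat (length (vertex_list H)) (length (vertex_list H))"
  by (simp add: adj_matrix_def Let_def)

lemma char_poly_matrix_adj_matrix:
  assumes "finite (verts H)" and "tail H = fst" and "head H = snd"
  shows "char_poly_matrix (adj_matrix H) =
    mat (length (vertex_list H)) (length (vertex_list H))
      (\<lambda>(i, j). char_entry (arcs H) (vertex_list H ! i) (vertex_list H ! j))"
proof -
  have "{e \<in> arcs H. fst e = x \<and> snd e = y} = (if (x, y) \<in> arcs H then {(x, y)} else {})" for x y
    by auto
  then have "card {e \<in> arcs H. fst e = x \<and> snd e = y} = (if (x, y) \<in> arcs H then 1 else 0)" for x y
    by simp
  then show ?thesis
    using assms vertex_list(2)[OF assms(1)]
    by (intro eq_matI)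
      (auto simp: char_poly_matrix_def adj_matrix_def Let_def char_entry_def one_pCons nth_eq_iff_index_eq)
qed

lemma char_poly_adj_matrix:
  assumes "finite (verts H)" and "tail H = fst" and "head H = snd"
  shows "char_poly (adj_matrix H) = set_det (verts H) (char_entry (arcs H))"
  unfolding char_poly_def char_poly_matrix_adj_matrix[OF assms]
  using vertex_list[OF assms(1)] by (simp add: det_mat_list)

lemma sp_eq_iff:
  assumes "finite (verts H)" and "tail H = fst" and "head H = snd"
    and "finite (verts H')" and "tail H' = fst" and "head H' = snd"
  shows "sp H = sp H' \<longleftrightarrow>
    set_det (verts H) (char_entry (arcs H)) = set_det (verts H') (char_entry (arcs H'))"
  unfolding sp_def char_poly_adj_matrix[OF assms(1-3), symmetric] char_poly_adj_matrix[OF assms(4-6), symmetric]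
  using degree_monic_char_poly[OF adj_matrix_carrier[of H]] degree_monic_char_poly[OF adj_matrix_carrier[of H']]
  by (intro proots_eq_iff_monic) simp_all

text \<open>A diagonal cofactor has sign 1, and deleting row and column \<open>i\<close> amounts to
  dropping \<open>vs ! i\<close> from the enumeration.\<close>

lemma adj_mat_diagonal_list:
  assumes "distinct vs" and "i < length vs"
  shows "adj_mat (mat (length vs) (length vs) (\<lambda>(i, j). f (vs ! i) (vs ! j))) $$ (i, i) =
    set_det (set vs - {vs ! i}) f"
proof -
  define ws where "ws = take i vs @ drop (Suc i) vs"
  have len: "length ws = length vs - 1"
    using assms by (simp add: ws_def)
  have nth: "ws ! k = vs ! (if k < i then k else Suc k)" if "k < length vs - 1" for k
    using that assms by (auto simp: ws_def nth_append)
  note vs = id_take_nth_drop[OF assms(2)]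
  have "distinct (take i vs @ vs ! i # drop (Suc i) vs)"
    and "set vs = set (take i vs @ vs ! i # drop (Suc i) vs)"
    using assms(1) by (simp_all only: vs[symmetric])
  then have ws: "distinct ws" "set ws = set vs - {vs ! i}"
    by (auto simp: ws_def)
  have "mat_delete (mat (length vs) (length vs) (\<lambda>(i, j). f (vs ! i) (vs ! j))) i i =
      mat (length ws) (length ws) (\<lambda>(i, j). f (ws ! i) (ws ! j))"
    unfolding mat_delete_def len by (rule eq_matI) (auto simp: nth)
  then show ?thesis
    using assms by (simp add: adj_mat_def cofactor_def det_mat_list ws)
qed

lemma walk_regular_minor:
  assumes "walk_regular H" and "finite (verts H)" and "tail H = fst" and "head H = snd"
    and "x \<in> verts H" and "y \<in> verts H"
  shows "set_det (verts H - {x}) (char_entry (arcs H)) = set_det (verts H - {y}) (char_entry (arcs H))"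
proof -
  define vs where "vs = vertex_list H"
  have vs: "set vs = verts H" "distinct vs"
    using vertex_list assms by (simp_all add: vs_def)
  then obtain i j where ij: "i < length vs" "j < length vs" "x = vs ! i" "y = vs ! j"
    using assms by (metis in_set_conv_nth)
  have carrier: "adj_matrix H \<in> carrier_mat (length vs) (length vs)"
    by (simp add: vs_def adj_matrix_carrier)
  have "adj_mat (char_poly_matrix (adj_matrix H)) $$ (i, i) =
      adj_mat (char_poly_matrix (adj_matrix H)) $$ (j, j)"
  proof (rule adj_char_poly_matrix_diagonal[OF carrier _ ij(1,2)])
    show "(adj_matrix H ^\<^sub>m l) $$ (i, i) = (adj_matrix H ^\<^sub>m l) $$ (j, j)"
      if "i < length vs" "j < length vs" for l i j
      using assms(1) that unfolding walk_regular_def carrier_matD(1)[OF carrier] by blast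
  qed
  then show ?thesis
    using ij vs unfolding char_poly_matrix_adj_matrix[OF assms(2-4)] vs_def[symmetric]
    by (simp add: adj_mat_diagonal_list)
qed

section \<open>Effect of deletions, loops and pendant vertices\<close>

text \<open>The new loop lowers a single diagonal entry by 1, which is
  \<open>set_det_add_diagonal\<close> with \<open>c = - 1\<close>.\<close>

lemma set_det_insert_loop:
  assumes "finite S" and "a \<in> S" and "(a, a) \<notin> E"
  shows "set_det S (char_entry (insert (a, a) E)) =
    set_det S (char_entry E) - set_det (S - {a}) (char_entry E)"
proof -
  have "set_det S (char_entry (insert (a, a) E)) =
      set_det S (\<lambda>x y. if x = a \<and> y = a then char_entry E x y + (- 1) else char_entry E x y)"
    using assms by (intro set_det_cong refl) (auto simp: char_entry_def)
  then show ?thesis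
    by (simp only: set_det_add_diagonal[OF assms(1,2)]) simp
qed

lemma sp_remove_two_iff:
  assumes "finite (pverts G)"
  shows "sp (remove_two G u v) = sp (remove_two G w z) \<longleftrightarrow>
    set_det (pverts G - {u} - {v}) (char_entry (parcs G)) =
    set_det (pverts G - {w} - {z}) (char_entry (parcs G))"
proof -
  \<comment> \<open>Arcs lost with a deleted vertex affect only entries outside the remaining index
    set, so \<open>parcs G\<close> can be kept.\<close>
  have "set_det (verts (remove_two G u v)) (char_entry (arcs (remove_two G u v))) =
      set_det (pverts G - {u} - {v}) (char_entry (parcs G))" for u v
    by (rule set_det_cong)
      (auto simp: remove_two_def pre_digraph.del_vert_simps char_entry_def)
  then show ?thesis
    using assms
    by (subst sp_eq_iff) (simp_all add: remove_two_def pre_digraph.del_vert_simps)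
qed

lemma set_det_add_two_loops:
  assumes "pair_graph G" and "u \<in> pverts G" and "v \<in> pverts G" and "u \<noteq> v"
  shows "set_det (pverts G) (char_entry (insert (v, v) (insert (u, u) (parcs G)))) =
    set_det (pverts G) (char_entry (parcs G)) - set_det (pverts G - {u}) (char_entry (parcs G))
    - set_det (pverts G - {v}) (char_entry (parcs G)) + set_det (pverts G - {u} - {v}) (char_entry (parcs G))"
proof -
  interpret pair_graph G by fact
  have "(x, x) \<notin> parcs G" for x
    using pair_no_loops by force
  moreover have "pverts G - {v} - {u} = pverts G - {u} - {v}"
    by auto
  ultimately show ?thesis
    using assms pair_finite_verts by (simp add: set_det_insert_loop)
qed

text \<open>In \<open>set_det_pendant\<close> the corner entry is the indeterminate, since
  \<open>a \<noteq> b\<close> excludes a loop at \<open>b\<close>, and the two entries for the new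
  edge are -1 each, with product 1.\<close>

lemma set_det_add_pendant:
  assumes "finite S" and "a \<in> S" and "b \<notin> S"
    and "\<And>x. x \<in> insert b S \<Longrightarrow> (x, b) \<in> E \<longleftrightarrow> x = a"
    and "\<And>x. x \<in> insert b S \<Longrightarrow> (b, x) \<in> E \<longleftrightarrow> x = a"
  shows "set_det (insert b S) (char_entry E) =
    [:0, 1:] * set_det S (char_entry E) - set_det (S - {a}) (char_entry E)"
proof -
  have "a \<noteq> b"
    using assms by auto
  then show ?thesis
    using assms by (subst set_det_pendant[where u = a]) (auto simp: char_entry_def)
qed

text \<open>The pendant vertices are stripped one at a time: first \<open>Inr v\<close>, then
  \<open>Inr u\<close> from both resulting determinants, the one with \<open>Inl v\<close> and the
  one without.\<close>

lemma set_det_add_two_pendants: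
  fixes G :: "'a pair_pre_digraph"
  assumes "finite (pverts G)" and "u \<in> pverts G" and "v \<in> pverts G" and "u \<noteq> v"
  shows "set_det (verts (add_two_pendants G u v)) (char_entry (arcs (add_two_pendants G u v))) =
    [:0, 1:] * ([:0, 1:] * set_det (pverts G) (char_entry (parcs G)) - set_det (pverts G - {u}) (char_entry (parcs G)))
    - ([:0, 1:] * set_det (pverts G - {v}) (char_entry (parcs G)) - set_det (pverts G - {u} - {v}) (char_entry (parcs G)))"
proof -
  define E where "E = arcs (add_two_pendants G u v)"
  have E: "(Inl x, Inl y) \<in> E \<longleftrightarrow> (x, y) \<in> parcs G"
    "(Inl x, Inr y) \<in> E \<longleftrightarrow> x = y \<and> y \<in> {u, v}"
    "(Inr x, Inl y) \<in> E \<longleftrightarrow> x = y \<and> y \<in> {u, v}"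
    "(Inr x, Inr y) \<notin> E" for x y
    by (auto simp: E_def add_two_pendants_def)
  have pendant: "(c, Inr y) \<in> E \<longleftrightarrow> c = Inl y" "(Inr y, c) \<in> E \<longleftrightarrow> c = Inl y"
    if "y \<in> {u, v}" for c y
    using that by (cases c; auto simp: E)+
  have old: "set_det (Inl ` S) (char_entry E) = set_det S (char_entry (parcs G))"
    if "S \<subseteq> pverts G" for S
    using that assms
    by (subst set_det_image) (auto intro!: set_det_cong simp: char_entry_def E finite_subset)
  have verts: "verts (add_two_pendants G u v) = insert (Inr v) (insert (Inr u) (Inl ` pverts G))"
    by (auto simp: add_two_pendants_def)
  have del: "insert (Inr u) (Inl ` pverts G) - {Inl v} = insert (Inr u) (Inl ` (pverts G - {v}))"
    "Inl ` pverts G - {Inl u} = Inl ` (pverts G - {u})"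
    "Inl ` (pverts G - {v}) - {Inl u} = Inl ` (pverts G - {u} - {v})"
    by auto
  have v: "set_det (insert (Inr v) (insert (Inr u) (Inl ` pverts G))) (char_entry E) =
      [:0, 1:] * set_det (insert (Inr u) (Inl ` pverts G)) (char_entry E)
      - set_det (insert (Inr u) (Inl ` pverts G) - {Inl v}) (char_entry E)"
    using assms by (intro set_det_add_pendant) (simp_all add: pendant image_iff)
  have u: "set_det (insert (Inr u) (Inl ` pverts G)) (char_entry E) =
      [:0, 1:] * set_det (Inl ` pverts G) (char_entry E) - set_det (Inl ` pverts G - {Inl u}) (char_entry E)"
    using assms by (intro set_det_add_pendant) (simp_all add: pendant image_iff)
  have vu: "set_det (insert (Inr u) (Inl ` (pverts G - {v}))) (char_entry E) =
      [:0, 1:] * set_det (Inl ` (pverts G - {v})) (char_entry E)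
      - set_det (Inl ` (pverts G - {v}) - {Inl u}) (char_entry E)"
    using assms by (intro set_det_add_pendant) (simp_all add: pendant image_iff)
  show ?thesis
    unfolding verts E_def[symmetric] v u del vu
    by (simp only: old Diff_subset subset_refl subset_trans[OF Diff_subset Diff_subset])
qed

theorem lemma4p1:
  fixes G :: "'a pair_pre_digraph" and u v w z :: 'a
  assumes "pair_graph G"
    and "connected (with_proj G)"
    and "walk_regular (with_proj G)"
    and "u \<in> pverts G" and "v \<in> pverts G" and "u \<noteq> v"
    and "w \<in> pverts G" and "z \<in> pverts G" and "w \<noteq> z"
  shows "(sp (remove_two G u v) = sp (remove_two G w z) \<longleftrightarrow>
          sp (add_two_loops G u v) = sp (add_two_loops G w z)) \<and>
         (sp (add_two_loops G u v) = sp (add_two_loops G w z) \<longleftrightarrow>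
          sp (add_two_pendants G u v) = sp (add_two_pendants G w z))"
proof -
  interpret pair_graph G by fact
  note fin = pair_finite_verts
  define D where "D S = set_det S (char_entry (parcs G))" for S
  define V where "V = pverts G"
  define m where "m = D (V - {u})"
  have m: "D (V - {x}) = m" if "x \<in> V" for x
    using walk_regular_minor[OF assms(3), of x u] that assms(4) fin by (simp add: D_def V_def m_def)
  have removed: "sp (remove_two G u v) = sp (remove_two G w z) \<longleftrightarrow> D (V - {u} - {v}) = D (V - {w} - {z})"
    using fin by (simp add: sp_remove_two_iff D_def V_def)
  have loops: "verts (add_two_loops G x y) = V" "tail (add_two_loops G x y) = fst"
    "head (add_two_loops G x y) = snd"
    "set_det (verts (add_two_loops G x y)) (char_entry (arcs (add_two_loops G x y))) =
      D V - 2 * m + D (V - {x} - {y})" if "x \<in> V" "y \<in> V" "x \<noteq> y" for x y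
  proof -
    show v: "verts (add_two_loops G x y) = V"
      and "tail (add_two_loops G x y) = fst" "head (add_two_loops G x y) = snd"
      using that by (auto simp: add_two_loops_def pre_digraph.add_arc_def V_def)
    have a: "arcs (add_two_loops G x y) = insert (y, y) (insert (x, x) (parcs G))"
      by (simp add: add_two_loops_def pre_digraph.add_arc_def)
    show "set_det (verts (add_two_loops G x y)) (char_entry (arcs (add_two_loops G x y))) =
      D V - 2 * m + D (V - {x} - {y})"
      using set_det_add_two_loops[OF assms(1), of x y] that m unfolding v a
      by (simp add: D_def V_def)
  qed
  \<comment> \<open>\<open>D V\<close> and \<open>m\<close> do not depend on the chosen pair, so
    they cancel and only the minors with two vertices deleted are compared.\<close>
  have looped: "sp (add_two_loops G u v) = sp (add_two_loops G w z) \<longleftrightarrow>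
      D (V - {u} - {v}) = D (V - {w} - {z})"
    using assms(4-) fin loops(4)[of u v] loops(4)[of w z]
    by (subst sp_eq_iff) (simp_all add: loops(1-3) V_def[symmetric])
  have pendants: "finite (verts (add_two_pendants G x y))" "tail (add_two_pendants G x y) = fst"
    "head (add_two_pendants G x y) = snd" for x y
    using fin by (simp_all add: add_two_pendants_def)
  have pendant_det: "set_det (verts (add_two_pendants G x y)) (char_entry (arcs (add_two_pendants G x y))) =
      [:0, 1:] * ([:0, 1:] * D V - m) - ([:0, 1:] * m - D (V - {x} - {y}))"
    if "x \<in> V" "y \<in> V" "x \<noteq> y" for x y
    using set_det_add_two_pendants[OF fin that[unfolded V_def]] m[OF that(1)] m[OF that(2)]
    by (simp only: D_def V_def)
  have "sp (add_two_pendants G u v) = sp (add_two_pendants G w z) \<longleftrightarrow>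
      D (V - {u} - {v}) = D (V - {w} - {z})"
    \<comment> \<open>The same cancellation; without \<open>mult_pCons_left\<close> the products
      with \<open>[:0, 1:]\<close> are not expanded and match on both sides.\<close>
    using assms(4-) by (subst sp_eq_iff) (simp_all add: pendants pendant_det V_def[symmetric] del: mult_pCons_left)
  with removed looped show ?thesis
    by simp
qed

end
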